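(* Let $X$ be an involutive BE algebra which is implicative. Then $X$ is an implicative-orthomodular algebra if and only if $X$ is a pre-Wajsberg algebra.
   Context: A BE algebra is an algebra $(X,\to,1)$ of type $(2,0)$ such that for all $x,y,z\in X$: $x\to x=1$; $x\to 1=1$; $1\to x=x$; $x\to (y\to z)=y\to (x\to z)$. Write $x\le y$ iff $x\to y=1$. It is bounded if there is $0\in X$ with $0\le x$ for all $x\in X$; then $x^*:=x\to 0$. It is involutive if it is bounded and $x^{**}=x$ for all $x\in X$; an involutive BE algebra is denoted $(X,\to,^*,1)$. In an involutive BE algebra define $x\Cap y=((x^*\to y^* )\to y^* )^*$. A BE algebra is implicative if $(x\to y)\to x=x$ for all $x,y\in X$. An involutive BE algebra $X$ is called: - implicative-orthomodular if $x\to (y\Cap (z\Cap x))=(x\to y)\Cap (x\to z)$ for all $x,y,z\in X$; - pre-Wajsberg if $x\to (x\Cap y)=x\to y$ for all $x,y\in X$. *)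

theory Defs imports Main begin

locale be_algebra =
  fixes imp :: "'a \<Rightarrow> 'a \<Rightarrow> 'a" (infixr "\<rightarrow>" 60)
    and one :: "'a" ("\<one>")
  assumes imp_self: "x \<rightarrow> x = \<one>"
    and imp_one: "x \<rightarrow> \<one> = \<one>"
    and one_imp: "\<one> \<rightarrow> x = x"
    and imp_exchange: "x \<rightarrow> (y \<rightarrow> z) = y \<rightarrow> (x \<rightarrow> z)"
begin

definition le :: "'a \<Rightarrow> 'a \<Rightarrow> bool" (infix "\<preceq>" 50)
  where "x \<preceq> y \<longleftrightarrow> x \<rightarrow> y = \<one>"

end

text \<open>The order of a BE algebra need not be antisymmetric, so the bottom element is a parameter;
  in an involutive BE algebra it is unique.\<close>

locale bounded_be_algebra = be_algebra imp one
  for imp :: "'a \<Rightarrow> 'a \<Rightarrow> 'a" (infixr "\<rightarrow>" 60)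
    and one :: "'a" ("\<one>") +
  fixes zero :: "'a" ("\<zero>")
  assumes zero_le: "\<zero> \<preceq> x"
begin

definition neg :: "'a \<Rightarrow> 'a" ("_\<^sup>\<star>" [1000] 1000)
  where "x\<^sup>\<star> = x \<rightarrow> \<zero>"

definition Cap :: "'a \<Rightarrow> 'a \<Rightarrow> 'a" (infixl "\<Cap>" 70)
  where "x \<Cap> y = ((x\<^sup>\<star> \<rightarrow> y\<^sup>\<star>) \<rightarrow> y\<^sup>\<star>)\<^sup>\<star>"

end

locale involutive_be_algebra = bounded_be_algebra +
  assumes neg_neg: "x\<^sup>\<star>\<^sup>\<star> = x"

locale implicative_be_algebra = be_algebra +
  assumes implicative: "(x \<rightarrow> y) \<rightarrow> x = x"

locale implicative_orthomodular_algebra = involutive_be_algebra +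
  assumes implicative_orthomodular: "x \<rightarrow> (y \<Cap> (z \<Cap> x)) = (x \<rightarrow> y) \<Cap> (x \<rightarrow> z)"

locale pre_wajsberg_algebra = involutive_be_algebra +
  assumes pre_wajsberg: "x \<rightarrow> (x \<Cap> y) = x \<rightarrow> y"

end

theory Submission imports Defs begin

text \<open>With \<open>x \<squnion> y = x\<^sup>\<star> \<rightarrow> y\<close> and its De Morgan dual \<open>\<sqinter>\<close>, the implicative law is absorption, so an
  implicative involutive BE algebra is an ortholattice, in which \<open>x \<rightarrow> y = x\<^sup>\<star> \<squnion> y\<close> and \<open>x \<Cap> y\<close> is
  the Sasaki projection \<open>y \<sqinter> (y\<^sup>\<star> \<squnion> x)\<close>. Both identities in question are then equivalent to the
  orthomodular law \<open>x \<squnion> (x\<^sup>\<star> \<sqinter> (x \<squnion> z)) = x \<squnion> z\<close>.\<close>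

locale implicative_involutive_be_algebra =
  involutive_be_algebra imp one zero + implicative_be_algebra imp one
  for imp :: "'a \<Rightarrow> 'a \<Rightarrow> 'a" (infixr "\<rightarrow>" 60)
    and one :: "'a" ("\<one>")
    and zero :: "'a" ("\<zero>")
begin

definition join :: "'a \<Rightarrow> 'a \<Rightarrow> 'a" (infixl "\<squnion>" 65)
  where "x \<squnion> y = x\<^sup>\<star> \<rightarrow> y"

definition meet :: "'a \<Rightarrow> 'a \<Rightarrow> 'a" (infixl "\<sqinter>" 70)
  where "x \<sqinter> y = (x\<^sup>\<star> \<squnion> y\<^sup>\<star>)\<^sup>\<star>"

text \<open>Every upper bound of \<open>x\<close> has the form \<open>x \<squnion> z\<close>, so
  this is an equational form of the rule that \<open>a\<close> below \<open>b\<close> gives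
  \<open>a \<squnion> (a\<^sup>\<star> \<sqinter> b) = b\<close>.\<close>

definition orthomodular :: bool
  where "orthomodular \<longleftrightarrow> (\<forall>x z. x \<squnion> (x\<^sup>\<star> \<sqinter> (x \<squnion> z)) = x \<squnion> z)"

lemma imp_eq_join: "x \<rightarrow> y = x\<^sup>\<star> \<squnion> y"
  by (simp add: join_def neg_neg)

text \<open>This is contraposition: with \<open>y\<close> written as
  \<open>y\<^sup>\<star> \<rightarrow> \<zero>\<close>, the exchange law swaps the two
  antecedents.\<close>

lemma join_commute: "x \<squnion> y = y \<squnion> x"
proof -
  have "x\<^sup>\<star> \<rightarrow> y = x\<^sup>\<star> \<rightarrow> (y\<^sup>\<star> \<rightarrow> \<zero>)"
    using neg_neg[of y] by (simp add: neg_def)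
  also have "\<dots> = y\<^sup>\<star> \<rightarrow> (x\<^sup>\<star> \<rightarrow> \<zero>)"
    by (rule imp_exchange)
  also have "\<dots> = y\<^sup>\<star> \<rightarrow> x"
    using neg_neg[of x] by (simp add: neg_def)
  finally show ?thesis
    by (simp add: join_def)
qed

lemma join_left_commute: "x \<squnion> (y \<squnion> z) = y \<squnion> (x \<squnion> z)"
  by (simp add: join_def imp_exchange)

lemma join_assoc: "(x \<squnion> y) \<squnion> z = x \<squnion> (y \<squnion> z)"
  by (metis join_commute join_left_commute)

lemma neg_join: "(x \<squnion> y)\<^sup>\<star> = x\<^sup>\<star> \<sqinter> y\<^sup>\<star>"
  by (simp add: meet_def neg_neg)

lemma neg_meet: "(x \<sqinter> y)\<^sup>\<star> = x\<^sup>\<star> \<squnion> y\<^sup>\<star>"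
  by (simp add: meet_def neg_neg)

lemma meet_commute: "x \<sqinter> y = y \<sqinter> x"
  by (simp add: meet_def join_commute)

lemma meet_assoc: "(x \<sqinter> y) \<sqinter> z = x \<sqinter> (y \<sqinter> z)"
  by (simp add: meet_def neg_neg join_assoc)

lemma join_meet_absorb: "x \<squnion> (x \<sqinter> y) = x"
proof -
  \<comment> \<open>Taking \<open>y\<^sup>\<star>\<close> as second argument makes the complement of
    the inner implication equal to \<open>x \<sqinter> y\<close>.\<close>
  have "(x \<rightarrow> y\<^sup>\<star>) \<rightarrow> x = x"
    by (rule implicative)
  then show ?thesis
    by (simp add: imp_eq_join neg_join neg_neg join_commute)
qed

lemma meet_join_absorb: "x \<sqinter> (x \<squnion> y) = x"
  by (metis join_meet_absorb meet_def neg_join neg_neg)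

lemma join_idem: "x \<squnion> x = x"
  by (metis join_meet_absorb meet_join_absorb)

lemma one_meet: "\<one> \<sqinter> x = x"
proof -
  have "\<one>\<^sup>\<star> = \<zero>"
    by (simp add: neg_def one_imp)
  moreover have "\<zero> \<squnion> y = y" for y
    by (simp add: join_def neg_def imp_self one_imp)
  ultimately show ?thesis
    by (simp add: meet_def neg_neg)
qed

lemma Cap_eq_Sasaki: "x \<Cap> y = y \<sqinter> (y\<^sup>\<star> \<squnion> x)"
  by (simp add: Cap_def imp_eq_join neg_join neg_meet neg_neg join_commute meet_commute)

lemma one_Cap: "\<one> \<Cap> x = x"
  by (simp add: Cap_eq_Sasaki meet_commute one_meet imp_one flip: imp_eq_join)

lemma orthomodular_if_implicative_orthomodular:
  assumes iom: "\<And>x y z. x \<rightarrow> (y \<Cap> (z \<Cap> x)) = (x \<rightarrow> y) \<Cap> (x \<rightarrow> z)"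
  shows orthomodular
  unfolding orthomodular_def
proof (intro allI)
  fix x z
  \<comment> \<open>Putting \<open>\<one>\<close> for \<open>y\<close> removes the outer projection
    on the left and the first factor on the right.\<close>
  have "x\<^sup>\<star> \<rightarrow> (z \<Cap> x\<^sup>\<star>) = x\<^sup>\<star> \<rightarrow> z"
    using iom[of "x\<^sup>\<star>" \<one> z] by (simp add: one_Cap imp_one)
  then show "x \<squnion> (x\<^sup>\<star> \<sqinter> (x \<squnion> z)) = x \<squnion> z"
    by (simp add: imp_eq_join Cap_eq_Sasaki neg_neg)
qed

text \<open>Expanding the projections turns the left side into
  \<open>x\<^sup>\<star> \<squnion> (x \<sqinter> (c \<sqinter> d))\<close> and the right side into
  \<open>c \<sqinter> d\<close>. Since \<open>c \<sqinter> d\<close> lies above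
  \<open>x\<^sup>\<star>\<close>, the orthomodular law identifies the two.\<close>

lemma implicative_orthomodular_if_orthomodular:
  assumes orthomodular
  shows "x \<rightarrow> (y \<Cap> (z \<Cap> x)) = (x \<rightarrow> y) \<Cap> (x \<rightarrow> z)"
proof -
  define c where "c = x\<^sup>\<star> \<squnion> z"
  define d where "d = x\<^sup>\<star> \<squnion> (c\<^sup>\<star> \<squnion> y)"
  have below: "x\<^sup>\<star> \<squnion> (c \<sqinter> d) = c \<sqinter> d"
  proof -
    \<comment> \<open>Both \<open>c\<close> and \<open>d\<close> are joins with
      \<open>x\<^sup>\<star>\<close>, so absorption applies twice.\<close>
    have "x\<^sup>\<star> \<sqinter> (c \<sqinter> d) = x\<^sup>\<star>"
      by (simp add: c_def d_def meet_join_absorb flip: meet_assoc)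
    then show ?thesis
      by (metis join_commute join_meet_absorb meet_commute)
  qed
  have "x \<rightarrow> (y \<Cap> (z \<Cap> x)) = x\<^sup>\<star> \<squnion> (x \<sqinter> (c \<sqinter> d))"
    by (simp add: imp_eq_join Cap_eq_Sasaki neg_meet meet_assoc join_assoc flip: c_def d_def)
  also have "\<dots> = c \<sqinter> d"
    using assms[unfolded orthomodular_def, rule_format, of "x\<^sup>\<star>" "c \<sqinter> d"]
    by (simp add: below neg_neg)
  also have "\<dots> = (x \<rightarrow> y) \<Cap> (x \<rightarrow> z)"
    by (simp add: imp_eq_join Cap_eq_Sasaki d_def join_left_commute flip: c_def)
  finally show ?thesis .
qed

text \<open>Projecting \<open>x\<^sup>\<star>\<close> onto \<open>x \<squnion> z\<close> gives just
  their meet, because the complement of \<open>x \<squnion> z\<close> lies below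
  \<open>x\<^sup>\<star>\<close>.\<close>

lemma orthomodular_if_pre_wajsberg:
  assumes pre_wajsberg: "\<And>x y. x \<rightarrow> (x \<Cap> y) = x \<rightarrow> y"
  shows orthomodular
  unfolding orthomodular_def
proof (intro allI)
  fix x z
  let ?q = "x \<squnion> z"
  have "x \<squnion> (?q \<sqinter> (?q\<^sup>\<star> \<squnion> x\<^sup>\<star>)) = x \<squnion> ?q"
    using pre_wajsberg[of "x\<^sup>\<star>" ?q] by (simp add: imp_eq_join Cap_eq_Sasaki neg_neg)
  moreover have "?q\<^sup>\<star> \<squnion> x\<^sup>\<star> = x\<^sup>\<star>"
    by (simp add: neg_join join_commute[of _ "x\<^sup>\<star>"] join_meet_absorb)
  moreover have "x \<squnion> ?q = ?q"
    by (simp add: join_idem flip: join_assoc)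
  ultimately show "x \<squnion> (x\<^sup>\<star> \<sqinter> ?q) = ?q"
    by (simp add: meet_commute)
qed

text \<open>The orthomodular law splits \<open>y\<close> along its part
  \<open>x\<^sup>\<star> \<sqinter> y\<close>. Joining with \<open>x\<^sup>\<star>\<close> absorbs
  that part, and the remainder is exactly \<open>x \<Cap> y\<close>.\<close>

lemma pre_wajsberg_if_orthomodular:
  assumes orthomodular
  shows "x \<rightarrow> (x \<Cap> y) = x \<rightarrow> y"
proof -
  let ?m = "x\<^sup>\<star> \<sqinter> y"
  have split: "?m \<squnion> (?m\<^sup>\<star> \<sqinter> y) = y"
    using assms[unfolded orthomodular_def, rule_format, of ?m y]
    by (metis join_commute join_meet_absorb meet_commute)
  have "x \<rightarrow> y = x\<^sup>\<star> \<squnion> (?m \<squnion> (?m\<^sup>\<star> \<sqinter> y))"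
    by (simp add: imp_eq_join split)
  also have "\<dots> = x\<^sup>\<star> \<squnion> (?m\<^sup>\<star> \<sqinter> y)"
    by (simp add: join_meet_absorb flip: join_assoc)
  also have "\<dots> = x \<rightarrow> (x \<Cap> y)"
    by (simp add: imp_eq_join Cap_eq_Sasaki neg_meet neg_neg join_commute meet_commute)
  finally show ?thesis ..
qed

end

theorem corollary3p20:
  fixes imp :: "'a \<Rightarrow> 'a \<Rightarrow> 'a" and one zero :: "'a"
  assumes "involutive_be_algebra imp one zero"
    and "implicative_be_algebra imp one"
  shows "implicative_orthomodular_algebra imp one zero \<longleftrightarrow> pre_wajsberg_algebra imp one zero"
proof -
  interpret implicative_involutive_be_algebra imp one zero
    using assms by (rule implicative_involutive_be_algebra.intro)
  have "implicative_orthomodular_algebra imp one zero \<longleftrightarrow> orthomodular"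
  proof
    assume "implicative_orthomodular_algebra imp one zero"
    then interpret iom: implicative_orthomodular_algebra imp one zero .
    show orthomodular
      by (rule orthomodular_if_implicative_orthomodular) (rule iom.implicative_orthomodular)
  next
    assume orthomodular
    then show "implicative_orthomodular_algebra imp one zero"
      by unfold_locales (rule implicative_orthomodular_if_orthomodular)
  qed
  moreover have "pre_wajsberg_algebra imp one zero \<longleftrightarrow> orthomodular"
  proof
    assume "pre_wajsberg_algebra imp one zero"
    then interpret pw: pre_wajsberg_algebra imp one zero .
    show orthomodular
      by (rule orthomodular_if_pre_wajsberg) (rule pw.pre_wajsberg)
  next
    assume orthomodular
    then show "pre_wajsberg_algebra imp one zero"
      by unfold_locales (rule pre_wajsberg_if_orthomodular)
  qed
  ultimately show ?thesis
    by simp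
qed

end
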